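(* Let $f \in \mathcal{C}^{\beta}(\mathbb{R})$ and $g \in \mathcal{C}^{\gamma}(\mathbb{R})$ with $\beta+\gamma>1$. Then for all $s<t$, $$\int_s^t f(\tau)\,dg(\tau) = f(s)\,(g(t)-g(s)) + \sum_{k=1}^{\infty}\ \sum_{i=0}^{2^{k-1}-1} \Delta f(s+s_{2i}^k)\,\Delta g(s+s_{2i+1}^k),$$ where $s_i^k = \frac{i(t-s)}{2^k}$ for $0\le i\le 2^k$, and $\Delta h(s+s_i^k) = h(s+s_{i+1}^k)-h(s+s_i^k)$ for $h=f,g$ and $0\le i\le 2^k-1$.
   Context: For an interval $I\subseteq\mathbb{R}$ (possibly $I=\mathbb{R}$), $\mathcal{C}^{\beta}(I)$ denotes the space of real-valued H\"older-continuous functions on $I$ with exponent $\beta\in(0,1]$. The integral $\int_s^t f\,dg$ is the Stieltjes integral, i.e. the limit of Riemann sums $\sum_j f(\tau_j)(g(t_{j+1})-g(t_j))$ as the mesh of the partition of $[s,t]$ tends to $0$; by a theorem of Young and Kondurar it exists when $\beta+\gamma>1$. *)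

theory Defs
  imports Complex_Main
begin

definition holder_space :: "real \<Rightarrow> real set \<Rightarrow> (real \<Rightarrow> real) set" where
  "holder_space \<beta> I = {f. \<exists>C. \<forall>x\<in>I. \<forall>y\<in>I. \<bar>f x - f y\<bar> \<le> C * \<bar>x - y\<bar> powr \<beta>}"

text \<open>
  A tagged partition \<open>a = P 0 < P 1 < \<dots> < P n = b\<close> with tags
  \<open>\<tau> j \<in> [P j, P (j + 1)]\<close>. Values of \<open>P\<close> beyond \<open>n\<close> and of \<open>\<tau>\<close> from \<open>n\<close> on are irrelevant.
\<close>

definition tagged_partition ::
    "real \<Rightarrow> real \<Rightarrow> nat \<Rightarrow> (nat \<Rightarrow> real) \<Rightarrow> (nat \<Rightarrow> real) \<Rightarrow> bool" where
  "tagged_partition a b n P \<tau> \<longleftrightarrow>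
     P 0 = a \<and> P n = b \<and> (\<forall>j<n. P j < P (Suc j)) \<and> (\<forall>j<n. \<tau> j \<in> {P j..P (Suc j)})"

definition stieltjes_sum ::
    "(real \<Rightarrow> real) \<Rightarrow> (real \<Rightarrow> real) \<Rightarrow> nat \<Rightarrow> (nat \<Rightarrow> real) \<Rightarrow> (nat \<Rightarrow> real) \<Rightarrow> real" where
  "stieltjes_sum f g n P \<tau> = (\<Sum>j<n. f (\<tau> j) * (g (P (Suc j)) - g (P j)))"

definition has_stieltjes_integral ::
    "(real \<Rightarrow> real) \<Rightarrow> (real \<Rightarrow> real) \<Rightarrow> real \<Rightarrow> real \<Rightarrow> real \<Rightarrow> bool" where
  "has_stieltjes_integral f g a b J \<longleftrightarrow>
     (\<forall>\<epsilon>>0. \<exists>\<delta>>0. \<forall>n P \<tau>.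
        tagged_partition a b n P \<tau> \<and> (\<forall>j<n. P (Suc j) - P j < \<delta>)
          \<longrightarrow> \<bar>stieltjes_sum f g n P \<tau> - J\<bar> < \<epsilon>)"

definition stieltjes_integrable ::
    "(real \<Rightarrow> real) \<Rightarrow> (real \<Rightarrow> real) \<Rightarrow> real \<Rightarrow> real \<Rightarrow> bool" where
  "stieltjes_integrable f g a b \<longleftrightarrow> (\<exists>J. has_stieltjes_integral f g a b J)"

text \<open>
  For \<open>a < b\<close> the limit is unique when it exists; without integrability the value is unspecified.
\<close>

definition stieltjes_integral ::
    "(real \<Rightarrow> real) \<Rightarrow> (real \<Rightarrow> real) \<Rightarrow> real \<Rightarrow> real \<Rightarrow> real" where
  "stieltjes_integral f g a b = (THE J. has_stieltjes_integral f g a b J)"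

definition dyadic_point :: "real \<Rightarrow> real \<Rightarrow> nat \<Rightarrow> nat \<Rightarrow> real" where
  "dyadic_point s t k i = real i * (t - s) / 2 ^ k"

definition dyadic_increment ::
    "(real \<Rightarrow> real) \<Rightarrow> real \<Rightarrow> real \<Rightarrow> nat \<Rightarrow> nat \<Rightarrow> real" where
  "dyadic_increment h s t k i =
     h (s + dyadic_point s t k (i + 1)) - h (s + dyadic_point s t k i)"

definition dyadic_level_sum ::
    "(real \<Rightarrow> real) \<Rightarrow> (real \<Rightarrow> real) \<Rightarrow> real \<Rightarrow> real \<Rightarrow> nat \<Rightarrow> real" where
  "dyadic_level_sum f g s t k =
     (\<Sum>i = 0..2 ^ (k - 1) - 1.
        dyadic_increment f s t k (2 * i) * dyadic_increment g s t k (2 * i + 1))"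

end

theory Submission
  imports Defs
begin

text \<open>
  The integral is obtained from an approximate primitive: a function \<open>F\<close> on \<open>[s, t]\<close> with
  \<open>\<bar>F v - F u - f u * (g v - g u)\<bar> \<le> K * (v - u) powr \<theta>\<close> for some \<open>\<theta> > 1\<close>. Once such an \<open>F\<close>
  is known, every Riemann sum differs from \<open>F t - F s\<close> by at most
  \<open>K * (\<Sum>j. (P (j + 1) - P j) powr \<theta>)\<close>, which vanishes with the mesh because \<open>\<theta> > 1\<close>; so
  arbitrary partitions never have to be compared with each other
  (\<open>has_stieltjes_integral_if_approximate_primitive\<close>).

  Such an \<open>F\<close> exists with \<open>\<theta> = \<beta> + \<gamma>\<close>. Let \<open>F_n u\<close> be the left Riemann sum over the dyadic grid
  of level \<open>n\<close>, cut off at \<open>u\<close>. Halving a cell \<open>[a, b]\<close> with midpoint \<open>m\<close> changes its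
  contribution \<open>f a * (g b - g a)\<close> by \<open>(f m - f a) * (g b - g m)\<close>, which is of order
  \<open>h powr \<theta>\<close> for cells of length \<open>h\<close>. Only about \<open>(v - u) / h\<close> cells matter for the increment of
  \<open>F_n\<close> over \<open>[u, v]\<close> when \<open>h \<le> v - u\<close>, so one refinement changes this increment by
  \<open>O((v - u) * h powr (\<theta> - 1))\<close> (\<open>abs_primitive_approx_refine_le\<close>). This is a geometric series in
  the level. Starting at the level whose cells have about the length of \<open>[u, v]\<close>, where the
  increment consists of boundedly many terms (\<open>abs_primitive_approx_diff_le\<close>), the series sums to
  \<open>O((v - u) powr \<theta>)\<close>, which is the estimate for \<open>F = lim F_n\<close> (\<open>abs_primitive_diff_le\<close>).

  The series expansion is then a telescoping sum at \<open>u = t\<close>: there \<open>F_0 t = f s * (g t - g s)\<close>,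
  and the change from level \<open>k\<close> to level \<open>k + 1\<close>, a sum over all midpoints, is exactly the dyadic
  level sum.
\<close>

section \<open>Stieltjes integrals from approximate primitives\<close>

text \<open>
  A local error of order \<open>\<theta> > 1\<close> is summable to zero: it is at most the length of the cell times
  \<open>K * \<delta> powr (\<theta> - 1)\<close>, and the lengths add up to \<open>t - s\<close>.
\<close>

lemma has_stieltjes_integral_if_approximate_primitive:
  fixes f g F :: "real \<Rightarrow> real" and K \<theta> s t :: real
  assumes "1 < \<theta>" and "s < t" and "0 \<le> K"
    and local: "\<And>u v c. s \<le> u \<Longrightarrow> u < v \<Longrightarrow> v \<le> t \<Longrightarrow> c \<in> {u..v} \<Longrightarrow>
      \<bar>f c * (g v - g u) - (F v - F u)\<bar> \<le> K * (v - u) powr \<theta>"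
  shows "has_stieltjes_integral f g s t (F t - F s)"
  unfolding has_stieltjes_integral_def
proof (intro allI impI)
  fix \<epsilon> :: real assume "0 < \<epsilon>"
  \<comment> \<open>The mesh for which the total error \<open>K * \<delta> powr (\<theta> - 1) * (t - s)\<close> equals
    \<open>K / (K + 1) * \<epsilon>\<close>; the \<open>+ 1\<close> makes it strictly less than \<open>\<epsilon>\<close>, also for \<open>K = 0\<close>.\<close>
  define \<delta> where "\<delta> = (\<epsilon> / ((K + 1) * (t - s))) powr (1 / (\<theta> - 1))"
  have "0 < \<delta>" using \<open>0 < \<epsilon>\<close> \<open>0 \<le> K\<close> \<open>s < t\<close> by (simp add: \<delta>_def)
  have \<delta>_powr: "\<delta> powr (\<theta> - 1) = \<epsilon> / ((K + 1) * (t - s))"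
    using \<open>1 < \<theta>\<close> \<open>0 < \<epsilon>\<close> \<open>0 \<le> K\<close> \<open>s < t\<close> by (simp add: \<delta>_def powr_powr)
  have "\<bar>stieltjes_sum f g n P \<tau> - (F t - F s)\<bar> < \<epsilon>"
    if part: "tagged_partition s t n P \<tau>" and mesh: "\<forall>j<n. P (Suc j) - P j < \<delta>" for n P \<tau>
  proof -
    have ends: "P 0 = s" "P n = t" and step: "\<And>j. j < n \<Longrightarrow> P j < P (Suc j)"
      and tag: "\<And>j. j < n \<Longrightarrow> \<tau> j \<in> {P j..P (Suc j)}"
      using part by (auto simp: tagged_partition_def)
    have mono: "P i \<le> P j" if "i \<le> j" "j \<le> n" for i j
      using that
    proof (induction j rule: dec_induct)
      case (step m)
      then show ?case using \<open>\<And>j. j < n \<Longrightarrow> P j < P (Suc j)\<close>[of m] by auto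
    qed simp
    have cell: "\<bar>f (\<tau> j) * (g (P (Suc j)) - g (P j)) - (F (P (Suc j)) - F (P j))\<bar>
        \<le> K * (\<delta> powr (\<theta> - 1) * (P (Suc j) - P j))" if j: "j < n" for j
    proof -
      have pos: "0 < P (Suc j) - P j" using step[OF j] by simp
      have "\<bar>f (\<tau> j) * (g (P (Suc j)) - g (P j)) - (F (P (Suc j)) - F (P j))\<bar>
          \<le> K * (P (Suc j) - P j) powr \<theta>"
        using mono[of 0 j] mono[of "Suc j" n] j ends by (intro local step tag) auto
      also have "(P (Suc j) - P j) powr \<theta>
          = (P (Suc j) - P j) powr (\<theta> - 1) * (P (Suc j) - P j)"
        using pos powr_add[of "P (Suc j) - P j" "\<theta> - 1" 1] by simp
      also have "K * \<dots> \<le> K * (\<delta> powr (\<theta> - 1) * (P (Suc j) - P j))"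
        using pos mesh j \<open>1 < \<theta>\<close> \<open>0 \<le> K\<close>
        by (intro mult_left_mono mult_right_mono powr_mono2) (auto intro: less_imp_le)
      finally show ?thesis .
    qed
    have telescope: "(\<Sum>j<n. F (P (Suc j)) - F (P j)) = F t - F s"
      "(\<Sum>j<n. P (Suc j) - P j) = t - s"
      using sum_lessThan_telescope[of "\<lambda>j. F (P j)" n] sum_lessThan_telescope[of P n] ends
      by auto
    have "\<bar>stieltjes_sum f g n P \<tau> - (F t - F s)\<bar>
        = \<bar>\<Sum>j<n. f (\<tau> j) * (g (P (Suc j)) - g (P j)) - (F (P (Suc j)) - F (P j))\<bar>"
      unfolding stieltjes_sum_def telescope(1)[symmetric] by (simp only: sum_subtractf)
    also have "\<dots> \<le> (\<Sum>j<n. K * (\<delta> powr (\<theta> - 1) * (P (Suc j) - P j)))"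
      using cell by (intro order_trans[OF sum_abs] sum_mono) auto
    also have "\<dots> = K * (\<delta> powr (\<theta> - 1) * (t - s))"
      by (simp only: sum_distrib_left[symmetric] telescope(2))
    also have "\<dots> = K / (K + 1) * \<epsilon>"
      using \<open>s < t\<close> by (simp add: \<delta>_powr)
    also have "\<dots> < \<epsilon>" using \<open>0 < \<epsilon>\<close> \<open>0 \<le> K\<close> by (simp add: field_simps)
    finally show ?thesis .
  qed
  then show "\<exists>\<delta>>0. \<forall>n P \<tau>. tagged_partition s t n P \<tau> \<and> (\<forall>j<n. P (Suc j) - P j < \<delta>)
      \<longrightarrow> \<bar>stieltjes_sum f g n P \<tau> - (F t - F s)\<bar> < \<epsilon>"
    using \<open>0 < \<delta>\<close> by blast
qed

text \<open>
  Without arbitrarily fine partitions every number would be a limit of the Riemann sums; this is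
  what makes the integral unique.
\<close>
lemma fine_tagged_partition_exists:
  fixes s t \<delta> :: real
  assumes "s < t" "0 < \<delta>"
  shows "\<exists>n P \<tau>. tagged_partition s t n P \<tau> \<and> (\<forall>j<n. P (Suc j) - P j < \<delta>)"
proof -
  obtain m :: nat where m: "(t - s) / \<delta> < real m" using reals_Archimedean2 by blast
  define P where "P j = s + real j * ((t - s) / real m)" for j
  have "0 < real m" using m assms by (smt (verit) divide_pos_pos)
  then have fine: "(t - s) / real m < \<delta>" "0 < (t - s) / real m"
    using m assms by (simp_all add: field_simps)
  have step: "P (Suc j) - P j = (t - s) / real m" for j
    unfolding P_def of_nat_Suc distrib_right by simp
  have "P j \<le> P (Suc j)" "P j < P (Suc j)" for j
    using step[of j] fine(2) by linarith+
  moreover have "P 0 = s" "P m = t" using \<open>0 < real m\<close> by (simp_all add: P_def)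
  ultimately have "tagged_partition s t m P P"
    by (auto simp: tagged_partition_def)
  moreover have "\<forall>j<m. P (Suc j) - P j < \<delta>" using step fine(1) by simp
  ultimately show ?thesis by blast
qed

lemma has_stieltjes_integral_unique:
  assumes "has_stieltjes_integral f g s t J" "has_stieltjes_integral f g s t J'" "s < t"
  shows "J = J'"
proof (rule ccontr)
  assume "J \<noteq> J'"
  define \<epsilon> where "\<epsilon> = \<bar>J - J'\<bar> / 2"
  have "0 < \<epsilon>" using \<open>J \<noteq> J'\<close> by (simp add: \<epsilon>_def)
  obtain \<delta> where \<delta>: "0 < \<delta>" "\<And>n P \<tau>. tagged_partition s t n P \<tau> \<Longrightarrow>
      \<forall>j<n. P (Suc j) - P j < \<delta> \<Longrightarrow> \<bar>stieltjes_sum f g n P \<tau> - J\<bar> < \<epsilon>"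
    using assms(1) \<open>0 < \<epsilon>\<close> unfolding has_stieltjes_integral_def by meson
  obtain \<delta>' where \<delta>': "0 < \<delta>'" "\<And>n P \<tau>. tagged_partition s t n P \<tau> \<Longrightarrow>
      \<forall>j<n. P (Suc j) - P j < \<delta>' \<Longrightarrow> \<bar>stieltjes_sum f g n P \<tau> - J'\<bar> < \<epsilon>"
    using assms(2) \<open>0 < \<epsilon>\<close> unfolding has_stieltjes_integral_def by meson
  obtain n P \<tau> where "tagged_partition s t n P \<tau>" "\<forall>j<n. P (Suc j) - P j < min \<delta> \<delta>'"
    using fine_tagged_partition_exists[OF \<open>s < t\<close>, of "min \<delta> \<delta>'"] \<delta>(1) \<delta>'(1) by auto
  then have "\<bar>stieltjes_sum f g n P \<tau> - J\<bar> < \<epsilon>" "\<bar>stieltjes_sum f g n P \<tau> - J'\<bar> < \<epsilon>"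
    by (auto intro: \<delta>(2) \<delta>'(2))
  then show False by (auto simp: \<epsilon>_def abs_if field_simps split: if_splits)
qed

section \<open>Sums over dyadic cells\<close>

text \<open>
  The bound is uniform in the starting index \<open>n\<close>, which will be chosen according to the scale at
  which \<open>X n\<close> is easy to estimate.
\<close>
lemma geometric_increments_imp_limit:
  fixes X :: "nat \<Rightarrow> real"
  assumes step: "\<And>k. n \<le> k \<Longrightarrow> \<bar>X (Suc k) - X k\<bar> \<le> M * q ^ k" and "0 \<le> q" "q < 1"
  shows "\<exists>L. X \<longlonglongrightarrow> L \<and> \<bar>L - X n\<bar> \<le> M * q ^ n / (1 - q)"
proof -
  define d where "d k = X (Suc (k + n)) - X (k + n)" for k
  have geom: "(\<lambda>k. M * q ^ n * q ^ k) sums (M * q ^ n * (1 / (1 - q)))"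
    using \<open>0 \<le> q\<close> \<open>q < 1\<close> by (intro sums_mult geometric_sums) simp
  have bound: "norm (d k) \<le> M * q ^ n * q ^ k" for k
    using step[of "k + n"] by (simp add: d_def power_add mult_ac)
  have summ: "summable d"
    using bound by (intro summable_comparison_test[OF _ sums_summable[OF geom]]) auto
  have "norm (suminf d) \<le> M * q ^ n / (1 - q)"
    using norm_suminf_le[OF bound sums_summable[OF geom]] sums_unique[OF geom] by simp
  moreover have "(\<lambda>m. X (m + n) - X n) \<longlonglongrightarrow> suminf d"
  proof -
    have "(\<Sum>k<m. d k) = X (m + n) - X n" for m
      using sum_lessThan_telescope[of "\<lambda>k. X (k + n)" m] by (simp add: d_def)
    then show ?thesis using summable_LIMSEQ[OF summ] by simp
  qed
  then have "(\<lambda>m. X (m + n)) \<longlonglongrightarrow> suminf d + X n"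
    using tendsto_add[OF _ tendsto_const[of "X n"]] by fastforce
  then have "X \<longlonglongrightarrow> suminf d + X n" by (rule LIMSEQ_offset)
  ultimately show ?thesis by (intro exI[of _ "suminf d + X n"]) simp
qed

lemma sum_even_odd_pairs:
  fixes a :: "nat \<Rightarrow> 'a::comm_monoid_add"
  shows "(\<Sum>i<2 * N. a i) = (\<Sum>i<N. a (2 * i) + a (2 * i + 1))"
  by (induction N) (simp_all add: add.assoc)

text \<open>
  The constant 2 accounts for the two cells that may stick out of the interval. It matters that
  the bound does not grow with \<open>N\<close>: the increment of a cut-off Riemann sum over a short interval
  involves only the cells there.
\<close>
lemma card_grid_cells_meeting_interval:
  fixes h s u v :: real
  assumes "0 < h" "u \<le> v"
  shows "real (card {i. i < N \<and> s + real i * h < v \<and> u < s + real (Suc i) * h})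
    \<le> (v - u) / h + 2"
proof -
  define a b where "a = \<lfloor>(u - s) / h\<rfloor>" and "b = \<lfloor>(v - s) / h\<rfloor>"
  let ?S = "{i. i < N \<and> s + real i * h < v \<and> u < s + real (Suc i) * h}"
  have "int ` ?S \<subseteq> {a..b}"
  proof (intro subsetI, elim imageE CollectE conjE, simp only:)
    fix i assume "s + real i * h < v" "u < s + real (Suc i) * h"
    then have "(u - s) / h < real_of_int (int i + 1)" "real_of_int (int i) \<le> (v - s) / h"
      using \<open>0 < h\<close> by (simp_all add: field_simps)
    then show "int i \<in> {a..b}" unfolding a_def b_def
      by (simp add: floor_le_iff le_floor_iff)
  qed
  then have "card (int ` ?S) \<le> card {a..b}" by (intro card_mono) auto
  then have "card ?S \<le> nat (b + 1 - a)" by (simp add: card_image)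
  moreover have "a \<le> b" unfolding a_def b_def
    using assms by (intro floor_mono divide_right_mono) auto
  ultimately have "real (card ?S) \<le> real_of_int b + 1 - real_of_int a" by linarith
  also have "\<dots> \<le> (v - s) / h + 1 - ((u - s) / h - 1)"
    unfolding a_def b_def by linarith
  also have "\<dots> = (v - u) / h + 2" by (simp add: field_simps diff_divide_distrib)
  finally show ?thesis .
qed

lemma abs_sum_over_cells_meeting_interval_le:
  fixes h s u v M :: real and e :: "nat \<Rightarrow> real"
  assumes "0 < h" "u \<le> v" "0 \<le> M"
    and outside: "\<And>i. i < N \<Longrightarrow> v \<le> s + real i * h \<or> s + real (Suc i) * h \<le> u \<Longrightarrow> e i = 0"
    and inside: "\<And>i. i < N \<Longrightarrow> s + real i * h < v \<Longrightarrow> u < s + real (Suc i) * h \<Longrightarrow> \<bar>e i\<bar> \<le> M"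
  shows "\<bar>\<Sum>i<N. e i\<bar> \<le> ((v - u) / h + 2) * M"
proof -
  let ?S = "{i. i < N \<and> s + real i * h < v \<and> u < s + real (Suc i) * h}"
  have "(\<Sum>i<N. e i) = (\<Sum>i\<in>?S. e i)"
    using outside by (intro sum.mono_neutral_right) (auto simp del: of_nat_Suc simp flip: not_less)
  also have "\<bar>\<dots>\<bar> \<le> (\<Sum>i\<in>?S. M)"
    using inside by (intro order_trans[OF sum_abs] sum_mono) auto
  also have "\<dots> \<le> ((v - u) / h + 2) * M"
    using card_grid_cells_meeting_interval[OF assms(1,2), of N s] \<open>0 \<le> M\<close>
    by (simp add: mult_right_mono)
  finally show ?thesis .
qed

text \<open>
  The increment over \<open>[u, v]\<close> of a Riemann sum cut off at its upper end is again a Riemann sum, with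
  the grid points projected to \<open>[u, v]\<close>.
\<close>
definition clip :: "real \<Rightarrow> real \<Rightarrow> real \<Rightarrow> real" where
  "clip u v x = max u (min v x)"

lemma abs_clip_diff_le: "\<bar>clip u v x - clip u v y\<bar> \<le> \<bar>x - y\<bar>"
  by (auto simp: clip_def max_def min_def)

section \<open>The approximate primitive of a pair of Hoelder functions\<close>
locale holder_pair =
  fixes f g :: "real \<Rightarrow> real" and \<beta> \<gamma> C D s t :: real
  assumes f_holder: "\<bar>f x - f y\<bar> \<le> C * \<bar>x - y\<bar> powr \<beta>"
    and g_holder: "\<bar>g x - g y\<bar> \<le> D * \<bar>x - y\<bar> powr \<gamma>"
    and exponents: "0 < \<beta>" "0 < \<gamma>" "1 < \<beta> + \<gamma>"
    and interval: "s < t"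
begin

definition mesh :: "nat \<Rightarrow> real" where
  "mesh n = (t - s) / 2 ^ n"

definition node :: "nat \<Rightarrow> nat \<Rightarrow> real" where
  "node n i = s + real i * mesh n"

text \<open>
  The cell containing \<open>u\<close> contributes up to \<open>u\<close>, and the later cells contribute nothing. Keeping
  the partial cell makes the halving of cells change the sum by the same formula for every \<open>u\<close>,
  dyadic or not.
\<close>
definition primitive_approx :: "nat \<Rightarrow> real \<Rightarrow> real" where
  "primitive_approx n u =
    (\<Sum>i<2 ^ n. f (node n i) * (g (min u (node n (Suc i))) - g (min u (node n i))))"

definition primitive :: "real \<Rightarrow> real" where
  "primitive u = lim (\<lambda>n. primitive_approx n u)"

lemma constants_nonneg: "0 \<le> C" "0 \<le> D"
  using f_holder[of 1 0] g_holder[of 1 0] by auto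

lemma mesh_pos: "0 < mesh n"
  using interval by (simp add: mesh_def)

lemma mesh_Suc: "mesh n = 2 * mesh (Suc n)"
  by (simp add: mesh_def field_simps)

lemma node_Suc: "node n (Suc i) = node n i + mesh n"
  by (simp add: node_def algebra_simps)

lemma node_even: "node (Suc n) (2 * i) = node n i"
  by (simp add: node_def mesh_def)

lemma node_odd: "node (Suc n) (Suc (2 * i)) = node n i + mesh (Suc n)"
  by (simp add: node_Suc node_even)

lemma node_0: "node n 0 = s"
  by (simp add: node_def)

lemma node_last: "node n (2 ^ n) = t"
  by (simp add: node_def mesh_def)

lemma node_mono: "i \<le> j \<Longrightarrow> node n i \<le> node n j"
  using mesh_pos[of n] by (simp add: node_def mult_right_mono)

text \<open>
  This is how the Hoelder bounds enter every estimate: the errors are products of an increment of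
  \<open>f\<close> and one of \<open>g\<close> over comparable lengths, and their combined order \<open>\<beta> + \<gamma>\<close> exceeds 1.
\<close>
lemma abs_increment_product_le:
  assumes "\<bar>x - y\<bar> \<le> a" "\<bar>z - w\<bar> \<le> a"
  shows "\<bar>(f x - f y) * (g z - g w)\<bar> \<le> C * D * a powr (\<beta> + \<gamma>)"
proof -
  have "\<bar>f x - f y\<bar> \<le> C * a powr \<beta>"
    using f_holder[of x y] assms(1) exponents constants_nonneg
    by (meson abs_ge_zero less_imp_le mult_left_mono order_trans powr_mono2)
  moreover have "\<bar>g z - g w\<bar> \<le> D * a powr \<gamma>"
    using g_holder[of z w] assms(2) exponents constants_nonneg
    by (meson abs_ge_zero less_imp_le mult_left_mono order_trans powr_mono2)
  ultimately have "\<bar>f x - f y\<bar> * \<bar>g z - g w\<bar> \<le> (C * a powr \<beta>) * (D * a powr \<gamma>)"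
    using constants_nonneg by (intro mult_mono) auto
  then show ?thesis by (simp add: abs_mult powr_add mult_ac)
qed

lemma primitive_approx_diff:
  assumes "u \<le> v"
  shows "primitive_approx n v - primitive_approx n u =
    (\<Sum>i<2 ^ n. f (node n i) * (g (clip u v (node n (Suc i))) - g (clip u v (node n i))))"
proof -
  have "g (min v x) - g (min u x) = g (clip u v x) - g u" for x
    using assms by (auto simp: clip_def max_def min_def)
  then have key: "g (min v x) - g (min v y) - (g (min u x) - g (min u y))
      = g (clip u v x) - g (clip u v y)" for x y
    by (smt (verit))
  show ?thesis
    unfolding primitive_approx_def sum_subtractf[symmetric] right_diff_distrib[symmetric] key ..
qed

text \<open>
  On a cell \<open>[a, b]\<close> with midpoint \<open>m\<close>, the refined terms
  \<open>f a * (g m - g a) + f m * (g b - g m)\<close> exceed \<open>f a * (g b - g a)\<close> by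
  \<open>(f m - f a) * (g b - g m)\<close>.
\<close>
lemma primitive_approx_diff_refine:
  assumes "u \<le> v"
  shows "(primitive_approx (Suc n) v - primitive_approx (Suc n) u)
      - (primitive_approx n v - primitive_approx n u)
    = (\<Sum>i<2 ^ n. (f (node (Suc n) (2 * i + 1)) - f (node (Suc n) (2 * i))) *
        (g (clip u v (node (Suc n) (2 * i + 2))) - g (clip u v (node (Suc n) (2 * i + 1)))))"
proof -
  have coarse: "node n i = node (Suc n) (2 * i)" "node n (Suc i) = node (Suc n) (2 * i + 2)" for i
    using node_even[of n i] node_even[of n "Suc i"] by simp_all
  show ?thesis
    unfolding primitive_approx_diff[OF assms] power_Suc sum_even_odd_pairs coarse
      sum_subtractf[symmetric]
    by (intro sum.cong) (simp_all add: algebra_simps)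
qed

text \<open>
  At most \<open>(v - u) / mesh n + 2 \<le> 3 * (v - u) / mesh n\<close> cells meet the interval, and each of them
  contributes \<open>C * D * mesh n powr (\<beta> + \<gamma>)\<close>. The exponent left over for the mesh is positive, so
  these bounds decrease geometrically with the level.
\<close>
lemma abs_primitive_approx_refine_le:
  assumes "u < v" "mesh n \<le> v - u"
  shows "\<bar>(primitive_approx (Suc n) v - primitive_approx (Suc n) u)
      - (primitive_approx n v - primitive_approx n u)\<bar>
    \<le> 3 * C * D * (v - u) * mesh n powr (\<beta> + \<gamma> - 1)"
proof -
  let ?M = "C * D * mesh n powr (\<beta> + \<gamma>)"
  have le: "mesh (Suc n) \<le> mesh n" using mesh_Suc[of n] mesh_pos[of "Suc n"] by simp
  have next2: "node (Suc n) (2 * i + 2) = node n (Suc i)" for i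
    using node_even[of n "Suc i"] by simp
  have "\<bar>(primitive_approx (Suc n) v - primitive_approx (Suc n) u)
      - (primitive_approx n v - primitive_approx n u)\<bar> \<le> ((v - u) / mesh n + 2) * ?M"
    unfolding primitive_approx_diff_refine[OF less_imp_le[OF \<open>u < v\<close>]]
  proof (intro abs_sum_over_cells_meeting_interval_le[where s = s] mesh_pos, goal_cases)
    case (3 i)
    then have "v \<le> node n i \<or> node n (Suc i) \<le> u" by (simp add: node_def)
    then have "clip u v (node (Suc n) (2 * i + 2)) = clip u v (node (Suc n) (2 * i + 1))"
      using node_odd[of n i] node_Suc[of n i] mesh_Suc[of n] mesh_pos[of "Suc n"] \<open>u < v\<close>
      unfolding next2 by (auto simp: clip_def)
    then show ?case by simp
  next
    case (4 i)
    have "\<bar>node (Suc n) (2 * i + 1) - node (Suc n) (2 * i)\<bar> \<le> mesh n"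
      "\<bar>node (Suc n) (2 * i + 2) - node (Suc n) (2 * i + 1)\<bar> \<le> mesh n"
      using node_odd[of n i] node_even[of n i] node_Suc[of n i] next2[of i] le mesh_Suc[of n]
        mesh_pos[of "Suc n"] by (auto simp del: mult_Suc_right)
    then show ?case
      by (intro abs_increment_product_le order_trans[OF abs_clip_diff_le])
  qed (use \<open>u < v\<close> constants_nonneg in auto)
  also have "\<dots> \<le> (3 * (v - u) / mesh n) * ?M"
    using assms mesh_pos[of n] constants_nonneg le_divide_eq[of 1 "v - u" "mesh n"]
    by (intro mult_right_mono) (auto simp: right_diff_distrib diff_divide_distrib)
  also have "mesh n powr (\<beta> + \<gamma>) = mesh n powr (\<beta> + \<gamma> - 1) * mesh n"
    using mesh_pos[of n] powr_add[of "mesh n" "\<beta> + \<gamma> - 1" 1] by simp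
  also have "(3 * (v - u) / mesh n) * (C * D * \<dots>)
      = 3 * C * D * (v - u) * mesh n powr (\<beta> + \<gamma> - 1)"
    using mesh_pos[of n] by simp
  finally show ?thesis .
qed

text \<open>
  At the scale of the interval, at most \<open>(v - u) / mesh n + 2 \<le> 4\<close> cells meet it, all within
  distance \<open>v - u\<close> of \<open>u\<close>, so that replacing \<open>f\<close> at the left nodes by \<open>f u\<close> costs four error terms.
  The upper bound on the mesh controls the size of these terms and the lower bound controls their
  number.
\<close>
lemma abs_primitive_approx_diff_le:
  assumes "s \<le> u" "u < v" "v \<le> t" "mesh n \<le> v - u" "v - u \<le> 2 * mesh n"
  shows "\<bar>primitive_approx n v - primitive_approx n u - f u * (g v - g u)\<bar>
    \<le> 4 * C * D * (v - u) powr (\<beta> + \<gamma>)"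
proof -
  let ?M = "C * D * (v - u) powr (\<beta> + \<gamma>)"
  let ?G = "\<lambda>i. g (clip u v (node n (Suc i))) - g (clip u v (node n i))"
  have "(\<Sum>i<2 ^ n. ?G i) = g (clip u v t) - g (clip u v s)"
    using sum_lessThan_telescope[of "\<lambda>i. g (clip u v (node n i))" "2 ^ n"]
    by (simp add: node_0 node_last)
  also have "\<dots> = g v - g u" using assms by (simp add: clip_def)
  finally have "primitive_approx n v - primitive_approx n u - f u * (g v - g u)
      = (\<Sum>i<2 ^ n. (f (node n i) - f u) * ?G i)"
    using primitive_approx_diff[of u v n] \<open>u < v\<close>
    by (simp add: left_diff_distrib sum_subtractf sum_distrib_left[symmetric])
  also have "\<bar>\<dots>\<bar> \<le> ((v - u) / mesh n + 2) * ?M"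
  proof (intro abs_sum_over_cells_meeting_interval_le[where s = s] mesh_pos, goal_cases)
    case (3 i)
    then have "v \<le> node n i \<or> node n (Suc i) \<le> u" by (simp add: node_def)
    then have "clip u v (node n (Suc i)) = clip u v (node n i)"
      using node_Suc[of n i] mesh_pos[of n] \<open>u < v\<close> by (auto simp: clip_def)
    then show ?case by simp
  next
    case (4 i)
    then have "node n i < v" "u < node n (Suc i)" by (simp_all add: node_def)
    then have "\<bar>node n i - u\<bar> \<le> v - u" "\<bar>node n (Suc i) - node n i\<bar> \<le> v - u"
      using node_Suc[of n i] mesh_pos[of n] assms by auto
    then show ?case
      by (intro abs_increment_product_le order_trans[OF abs_clip_diff_le])
  qed (use \<open>u < v\<close> constants_nonneg in auto)
  also have "\<dots> \<le> 4 * ?M"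
    using assms mesh_pos[of n] constants_nonneg
    by (intro mult_right_mono) (auto simp: field_simps)
  finally show ?thesis by simp
qed

text \<open>The factor by which \<open>mesh n powr (\<beta> + \<gamma> - 1)\<close> shrinks when \<open>n\<close> increases by one.\<close>
definition ratio :: real where
  "ratio = 2 powr (1 - (\<beta> + \<gamma>))"

lemma ratio_bounds: "0 \<le> ratio" "ratio < 1"
  using exponents by (auto simp: ratio_def powr_less_one)

lemma mesh_powr: "mesh n powr (\<beta> + \<gamma> - 1) = (t - s) powr (\<beta> + \<gamma> - 1) * ratio ^ n"
proof -
  have "ratio = 1 / 2 powr (\<beta> + \<gamma> - 1)"
    using powr_minus_divide[of 2 "\<beta> + \<gamma> - 1"] by (simp add: ratio_def)
  moreover have "(2 ^ n) powr (\<beta> + \<gamma> - 1) = (2 powr (\<beta> + \<gamma> - 1)) ^ n"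
    by (simp add: powr_power powr_powr flip: powr_realpow) (simp add: mult.commute)
  ultimately show ?thesis
    using interval by (simp add: mesh_def powr_divide power_one_over)
qed

lemma exists_comparable_mesh:
  assumes "s \<le> u" "u < v" "v \<le> t"
  shows "\<exists>n. mesh n \<le> v - u \<and> v - u \<le> 2 * mesh n"
proof -
  have "\<exists>n. mesh n \<le> v - u"
  proof -
    have "0 < (v - u) / (t - s)" using assms by simp
    then obtain n where "(1 / 2) ^ n < (v - u) / (t - s)"
      using real_arch_pow_inv[of "(v - u) / (t - s)" "1 / 2"] by auto
    then have "mesh n \<le> v - u" using interval by (simp add: mesh_def field_simps power_one_over)
    then show ?thesis ..
  qed
  define n where "n = (LEAST n. mesh n \<le> v - u)"
  have "mesh n \<le> v - u" unfolding n_def using \<open>\<exists>n. mesh n \<le> v - u\<close> by (rule LeastI_ex)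
  moreover have "v - u \<le> 2 * mesh n"
  proof (cases n)
    case 0
    then show ?thesis using assms by (simp add: mesh_def)
  next
    case (Suc m)
    then have "\<not> mesh m \<le> v - u" using not_less_Least[of m "\<lambda>n. mesh n \<le> v - u"] n_def by auto
    then show ?thesis using mesh_Suc[of m] Suc by simp
  qed
  ultimately show ?thesis by blast
qed

text \<open>
  The series of refinements is started at the level whose mesh is comparable to \<open>v - u\<close>: there
  the first term is already within \<open>O((v - u) powr (\<beta> + \<gamma>))\<close> of \<open>f u * (g v - g u)\<close>, and the tail,
  dominated by its first term, has the same order.
\<close>
lemma primitive_approx_diff_limit:
  assumes "s \<le> u" "u < v" "v \<le> t"
  shows "\<exists>L. (\<lambda>n. primitive_approx n v - primitive_approx n u) \<longlonglongrightarrow> L \<and>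
    \<bar>L - f u * (g v - g u)\<bar> \<le> (4 + 3 / (1 - ratio)) * C * D * (v - u) powr (\<beta> + \<gamma>)"
proof -
  let ?X = "\<lambda>n. primitive_approx n v - primitive_approx n u"
  let ?M = "3 * C * D * (v - u) * (t - s) powr (\<beta> + \<gamma> - 1)"
  obtain n where n: "mesh n \<le> v - u" "v - u \<le> 2 * mesh n"
    using exists_comparable_mesh[OF assms] by blast
  have "\<bar>?X (Suc k) - ?X k\<bar> \<le> ?M * ratio ^ k" if "n \<le> k" for k
  proof -
    have "mesh k \<le> mesh n" using that interval
      by (auto simp: mesh_def intro!: divide_left_mono power_increasing)
    then have "mesh k \<le> v - u" using n by simp
    from abs_primitive_approx_refine_le[OF \<open>u < v\<close> this]
    show ?thesis by (simp only: mesh_powr mult.assoc)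
  qed
  then obtain L where L: "?X \<longlonglongrightarrow> L" "\<bar>L - ?X n\<bar> \<le> ?M * ratio ^ n / (1 - ratio)"
    using geometric_increments_imp_limit[of n ?X ?M ratio] ratio_bounds by blast
  have "?M * ratio ^ n = 3 * C * D * ((v - u) * mesh n powr (\<beta> + \<gamma> - 1))"
    by (simp only: mesh_powr mult.assoc)
  also have "\<dots> \<le> 3 * C * D * ((v - u) * (v - u) powr (\<beta> + \<gamma> - 1))"
    using n mesh_pos[of n] constants_nonneg exponents assms
    by (intro mult_left_mono powr_mono2) auto
  also have "(v - u) * (v - u) powr (\<beta> + \<gamma> - 1) = (v - u) powr (\<beta> + \<gamma>)"
    using powr_add[of "v - u" "\<beta> + \<gamma> - 1" 1] assms by simp
  finally have "?M * ratio ^ n / (1 - ratio)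
      \<le> 3 * C * D * (v - u) powr (\<beta> + \<gamma>) / (1 - ratio)"
    using ratio_bounds by (intro divide_right_mono) auto
  then have "\<bar>L - f u * (g v - g u)\<bar> \<le> 3 * C * D * (v - u) powr (\<beta> + \<gamma>) / (1 - ratio)
      + 4 * C * D * (v - u) powr (\<beta> + \<gamma>)"
    using L(2) abs_primitive_approx_diff_le[OF assms n] by linarith
  also have "\<dots> = (4 + 3 / (1 - ratio)) * C * D * (v - u) powr (\<beta> + \<gamma>)"
    by (simp add: algebra_simps)
  finally show ?thesis using L(1) by blast
qed

lemma primitive_approx_start: "primitive_approx n s = 0"
proof -
  have "min s (node n i) = s" for i using node_mono[of 0 i n] by (simp add: node_0)
  then show ?thesis by (simp add: primitive_approx_def)
qed

lemma primitive_approx_tendsto: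
  assumes "s \<le> u" "u \<le> t"
  shows "(\<lambda>n. primitive_approx n u) \<longlonglongrightarrow> primitive u"
proof -
  have "convergent (\<lambda>n. primitive_approx n u)"
  proof (cases "u = s")
    case True
    then show ?thesis by (simp add: primitive_approx_start convergent_const)
  next
    case False
    then show ?thesis
      using primitive_approx_diff_limit[of s u] assms
      by (auto simp: primitive_approx_start convergent_def)
  qed
  then show ?thesis by (simp add: convergent_LIMSEQ_iff primitive_def)
qed

lemma abs_primitive_diff_le:
  assumes "s \<le> u" "u < v" "v \<le> t"
  shows "\<bar>primitive v - primitive u - f u * (g v - g u)\<bar>
    \<le> (4 + 3 / (1 - ratio)) * C * D * (v - u) powr (\<beta> + \<gamma>)"
proof -
  have "(\<lambda>n. primitive_approx n v - primitive_approx n u) \<longlonglongrightarrow> primitive v - primitive u"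
    using assms by (intro tendsto_diff primitive_approx_tendsto) auto
  then show ?thesis
    using primitive_approx_diff_limit[OF assms] LIMSEQ_unique by blast
qed

section \<open>The integral and its dyadic series\<close>

text \<open>
  The estimate for the primitive has the tag at the left end point; moving it to another point of
  the interval costs one more product of increments.
\<close>
lemma has_stieltjes_integral_primitive:
  "has_stieltjes_integral f g s t (primitive t - primitive s)"
proof (rule has_stieltjes_integral_if_approximate_primitive[OF exponents(3) interval])
  let ?K = "(4 + 3 / (1 - ratio)) * C * D + C * D"
  show "0 \<le> ?K" using ratio_bounds constants_nonneg by simp
  fix u v c assume uv: "s \<le> u" "u < v" "v \<le> t" and c: "c \<in> {u..v}"
  have "\<bar>(f c - f u) * (g v - g u)\<bar> \<le> C * D * (v - u) powr (\<beta> + \<gamma>)"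
    using uv c by (intro abs_increment_product_le) auto
  moreover have "f c * (g v - g u) - (primitive v - primitive u)
      = (f c - f u) * (g v - g u) - (primitive v - primitive u - f u * (g v - g u))"
    by (simp add: algebra_simps)
  ultimately show "\<bar>f c * (g v - g u) - (primitive v - primitive u)\<bar>
      \<le> ?K * (v - u) powr (\<beta> + \<gamma>)"
    using abs_primitive_diff_le[OF uv] unfolding distrib_right by linarith
qed

lemma primitive_approx_level_0: "primitive_approx 0 t = f s * (g t - g s)"
  using interval by (simp add: primitive_approx_def node_def mesh_def)

text \<open>
  Cutting off at \<open>t\<close> changes no grid point, so the formula for a refinement step loses its
  projections and becomes the level sum.
\<close>
lemma dyadic_level_sum_eq_primitive_approx_diff:
  "dyadic_level_sum f g s t (Suc k) = primitive_approx (Suc k) t - primitive_approx k t"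
proof -
  have node: "s + dyadic_point s t n i = node n i" for n i
    by (simp add: dyadic_point_def node_def mesh_def)
  have inside: "clip s t (node n i) = node n i" if "i \<le> 2 ^ n" for n i
    using node_mono[of 0 i n] node_mono[OF that, of n] by (simp add: clip_def node_0 node_last)
  have "{0..N - 1} = {..<N}" if "0 < N" for N :: nat using that by auto
  then have idx: "{0..2 ^ (Suc k - 1) - 1} = {..<(2::nat) ^ k}" by simp
  have "primitive_approx (Suc k) t - primitive_approx k t
      = (\<Sum>i<2 ^ k. (f (node (Suc k) (2 * i + 1)) - f (node (Suc k) (2 * i))) *
        (g (clip s t (node (Suc k) (2 * i + 2))) - g (clip s t (node (Suc k) (2 * i + 1)))))"
    using primitive_approx_diff_refine[OF less_imp_le[OF interval], of k]
    by (simp add: primitive_approx_start)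
  also have "\<dots> = dyadic_level_sum f g s t (Suc k)"
    unfolding dyadic_level_sum_def dyadic_increment_def idx node
    by (intro sum.cong) (auto simp: inside)
  finally show ?thesis ..
qed

lemma dyadic_level_sums:
  "(\<lambda>k. dyadic_level_sum f g s t (Suc k)) sums (primitive t - primitive s - f s * (g t - g s))"
proof -
  have "primitive s = 0"
    by (simp add: primitive_def primitive_approx_start)
  then show ?thesis
    using telescope_sums[OF primitive_approx_tendsto[of t]] interval
    by (simp add: dyadic_level_sum_eq_primitive_approx_diff primitive_approx_level_0)
qed

end

theorem theorem2:
  fixes f g :: "real \<Rightarrow> real" and \<beta> \<gamma> s t :: real
  assumes "0 < \<beta>" "\<beta> \<le> 1" and "0 < \<gamma>" "\<gamma> \<le> 1"
    and "f \<in> holder_space \<beta> UNIV" and "g \<in> holder_space \<gamma> UNIV"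
    and "\<beta> + \<gamma> > 1"
    and "s < t"
  shows "stieltjes_integrable f g s t \<and>
         summable (\<lambda>k. dyadic_level_sum f g s t (Suc k)) \<and>
         stieltjes_integral f g s t =
           f s * (g t - g s) + (\<Sum>k. dyadic_level_sum f g s t (Suc k))"
proof -
  obtain C D where "\<And>x y. \<bar>f x - f y\<bar> \<le> C * \<bar>x - y\<bar> powr \<beta>"
    "\<And>x y. \<bar>g x - g y\<bar> \<le> D * \<bar>x - y\<bar> powr \<gamma>"
    using assms(5,6) unfolding holder_space_def by auto
  then interpret holder_pair f g \<beta> \<gamma> C D s t
    using assms by unfold_locales auto
  have "stieltjes_integral f g s t = primitive t - primitive s"
    unfolding stieltjes_integral_def
    using has_stieltjes_integral_primitive has_stieltjes_integral_unique[OF _ _ \<open>s < t\<close>]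
    by (intro the_equality) auto
  then show ?thesis
    using has_stieltjes_integral_primitive dyadic_level_sums
    by (auto simp: stieltjes_integrable_def sums_iff)
qed

end
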